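(* For every $\beta>0$ there exists $C=C(\beta)$ such that the following holds for all $p\colon\mathbb{N}\to(0,1)$. If $\limsup_{n\to\infty} p(n)\le 2/3-\beta$, then asymptotically almost surely (with probability tending to $1$ as $n\to\infty$) every orientation of $G(n,p)$ with minimum outdegree at least $Cn^{1/2}$ contains a Seymour vertex.
   Context: $G(n,p)$ is the random graph with vertex set $\{1,\dots,n\}$ in which every pair of vertices appears as an edge independently and with probability $p=p(n)$. An orientation of a simple graph $G$ is a digraph obtained by assigning a direction to each edge of $G$. For a vertex $u$ of an oriented graph and $i\in\mathbb{N}$, $N^i(u)$ is the set of vertices $v$ for which a shortest directed path from $u$ to $v$ has precisely $i$ arcs. A Seymour vertex is a vertex $u$ with $|N^2(u)|\ge |N^1(u)|$. *)

theory Defs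
  imports "HOL-Probability.Probability" "Graph_Theory.Pair_Digraph"
begin

text \<open>
  As in \<^theory>\<open>Graph_Theory.Digraph\<close>, a simple undirected graph is a finite, loopfree, symmetric
  digraph (locale \<^locale>\<open>pair_graph\<close>): the edge \<open>uv\<close> is represented by both arcs
  \<open>(u, v)\<close> and \<open>(v, u)\<close>. The random choices below are indexed by unordered pairs, so that
  these two arcs are always present or absent together.
\<close>

definition vertex_pairs :: "nat \<Rightarrow> nat set set" where
  "vertex_pairs n = {e. e \<subseteq> {1..n} \<and> card e = 2}"

definition random_graph :: "nat \<Rightarrow> real \<Rightarrow> nat pair_pre_digraph pmf" where
  "random_graph n p =
     map_pmf (\<lambda>X. \<lparr>pverts = {1..n}, parcs = {(u, v). {u, v} \<in> vertex_pairs n \<and> X {u, v}}\<rparr>)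
       (Pi_pmf (vertex_pairs n) False (\<lambda>_. bernoulli_pmf p))"

definition is_orientation :: "'a pair_pre_digraph \<Rightarrow> 'a pair_pre_digraph \<Rightarrow> bool" where
  "is_orientation G D \<longleftrightarrow>
     pverts D = pverts G \<and> parcs D \<subseteq> parcs G \<and>
     (\<forall>(u, v) \<in> parcs G. (u, v) \<in> parcs D \<longleftrightarrow> (v, u) \<notin> parcs D)"

text \<open>Unspecified for the graph without vertices.\<close>

definition min_out_degree :: "'a pair_pre_digraph \<Rightarrow> nat" where
  "min_out_degree D = Min (out_degree (with_proj D) ` pverts D)"

text \<open>The vertices \<open>v\<close> such that a shortest directed path from \<open>u\<close> to \<open>v\<close> has exactly \<open>i\<close> arcs.\<close>

definition out_nbhd :: "'a pair_pre_digraph \<Rightarrow> nat \<Rightarrow> 'a \<Rightarrow> 'a set" where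
  "out_nbhd D i u =
     {v. \<exists>w. is_arg_min length (\<lambda>w. pre_digraph.apath (with_proj D) u w v) w \<and> length w = i}"

definition seymour_vertex :: "'a pair_pre_digraph \<Rightarrow> 'a \<Rightarrow> bool" where
  "seymour_vertex D u \<longleftrightarrow>
     u \<in> pverts D \<and> card (out_nbhd D 2 u) \<ge> card (out_nbhd D 1 u)"

lemma finite_vertex_pairs [simp]: "finite (vertex_pairs n)"
  by (rule finite_subset[of _ "Pow {1..n}"]) (auto simp: vertex_pairs_def)

lemma pair_graph_random_graph:
  assumes "G \<in> set_pmf (random_graph n p)"
  shows "pair_graph G"
proof -
  obtain X where G: "G = \<lparr>pverts = {1..n},
      parcs = {(u, v). {u, v} \<in> vertex_pairs n \<and> X {u, v}}\<rparr>"
    using assms by (auto simp: random_graph_def)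
  have "parcs G \<subseteq> {1..n} \<times> {1..n}"
    by (auto simp: G vertex_pairs_def)
  hence "finite (parcs G)"
    by (rule finite_subset) auto
  thus ?thesis
    by unfold_locales
       (auto simp: G vertex_pairs_def symmetric_def sym_def insert_commute card_insert_if)
qed

lemma prob_random_graph_edge:
  assumes "0 \<le> p" "p \<le> 1" "u \<in> {1..n}" "v \<in> {1..n}" "u \<noteq> v"
  shows "measure_pmf.prob (random_graph n p) {G. (u, v) \<in> parcs G} = p"
proof -
  have uv: "{u, v} \<in> vertex_pairs n"
    using assms by (auto simp: vertex_pairs_def)
  have "measure_pmf.prob (random_graph n p) {G. (u, v) \<in> parcs G} =
      measure_pmf.prob (map_pmf (\<lambda>X. X {u, v})
        (Pi_pmf (vertex_pairs n) False (\<lambda>_. bernoulli_pmf p))) {True}"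
    by (simp add: random_graph_def vimage_def uv)
  also have "map_pmf (\<lambda>X. X {u, v}) (Pi_pmf (vertex_pairs n) False (\<lambda>_. bernoulli_pmf p)) =
      bernoulli_pmf p"
    using uv by (simp add: Pi_pmf_component)
  finally show ?thesis
    using assms by (simp add: measure_pmf_single)
qed

lemma out_nbhd_1:
  assumes "pair_digraph D"
  shows "out_nbhd D 1 u = {v. (u, v) \<in> parcs D}"
proof -
  interpret pair_digraph D by fact
  have path0: "apath u [] v \<longleftrightarrow> u \<in> pverts D \<and> u = v" for v
    by (auto simp: apath_def awalk_def)
  have path1: "apath u [a] v \<longleftrightarrow> a = (u, v) \<and> (u, v) \<in> parcs D" for a v
    by (cases a) (auto simp: apath_def awalk_def dest: in_arcsD1 pair_no_loops)
  show ?thesis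
  proof (intro set_eqI iffI)
    fix v assume "v \<in> out_nbhd D 1 u"
    then show "v \<in> {v. (u, v) \<in> parcs D}"
      by (auto simp: out_nbhd_def is_arg_min_def length_Suc_conv path1)
  next
    fix v assume "v \<in> {v. (u, v) \<in> parcs D}"
    then have uv: "(u, v) \<in> parcs D" by simp
    then have "u \<noteq> v" using pair_no_loops by force
    then have "\<not> apath u w v" if "length w < 1" for w
      using that path0 by auto
    then have "is_arg_min length (\<lambda>w. apath u w v) [(u, v)]"
      using uv by (auto simp: is_arg_min_def path1)
    then show "v \<in> out_nbhd D 1 u"
      unfolding out_nbhd_def by force
  qed
qed

end

theory Submission
  imports Defs
begin

text \<open>
  Suppose that \<open>u\<close> has minimum outdegree \<open>a\<close> and is not a Seymour vertex, and put
  \<open>A = N\<^sup>1(u)\<close>, \<open>B = N\<^sup>2(u)\<close>. Every arc leaving \<open>A\<close> ends in \<open>A \<union> B\<close>, so at least \<open>a\<^sup>2\<close> edges of the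
  graph meet \<open>A\<close> and lie inside \<open>A \<union> B\<close>, although only \<open>3 a\<^sup>2 / 2\<close> vertex pairs do. In \<open>G(n,p)\<close> with
  \<open>p < 2/3 - \<beta>/2\<close> this exceeds the expected number of such edges by at least \<open>3 \<beta> a\<^sup>2 / 4\<close>, which by
  Hoeffding's inequality has probability at most \<open>exp (-3 \<beta>\<^sup>2 a\<^sup>2 / 4)\<close>. For \<open>a \<ge> 2 \<surd>n / \<beta>\<close> this is at
  most \<open>exp (-3 n)\<close>, which beats the number \<open>4\<^sup>n\<close> of choices of \<open>(A, B)\<close>.
\<close>

section \<open>Counting vertex pairs that meet a set\<close>

text \<open>Unordered like the index set \<open>vertex_pairs\<close> of the random choices, so that
  the two arcs representing an edge count once.\<close>

definition edge_set :: "'a pair_pre_digraph \<Rightarrow> 'a set set" where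
  "edge_set G = (\<lambda>(x, y). {x, y}) ` parcs G"

definition pairs_at :: "'a set \<Rightarrow> 'a set \<Rightarrow> 'a set set" where
  "pairs_at A B = {{x, y} | x y. x \<in> A \<and> y \<in> A \<union> B \<and> x \<noteq> y}"

lemma finite_pairs_at:
  assumes "finite A" "finite B"
  shows "finite (pairs_at A B)"
  by (rule finite_subset[of _ "Pow (A \<union> B)"]) (use assms in \<open>auto simp: pairs_at_def\<close>)

text \<open>With a the size of A, at most a(a - 1)/2 of these pairs lie inside A, and at most a *
  |B| \<le> a * a join A to B.\<close>

lemma card_pairs_at_le:
  assumes "finite A" "finite B" "card B \<le> card A"
  shows "real (card (pairs_at A B)) \<le> 3 / 2 * (real (card A))\<^sup>2"
proof -
  let ?P = "{e. e \<subseteq> A \<and> card e = 2}" and ?Q = "(\<lambda>(x, y). {x, y}) ` (A \<times> B)"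
  have "finite ?P"
    using assms by simp
  have "pairs_at A B \<subseteq> ?P \<union> ?Q"
    unfolding pairs_at_def by (force simp: card_2_iff)
  then have "card (pairs_at A B) \<le> card (?P \<union> ?Q)"
    by (intro card_mono) (use assms \<open>finite ?P\<close> in auto)
  also have "\<dots> \<le> card ?P + card ?Q"
    by (rule card_Un_le)
  also have "card ?P = card A choose 2"
    using assms by (simp add: n_subsets)
  also have "card ?Q \<le> card A * card B"
    using card_image_le[of "A \<times> B"] assms by (simp add: card_cartesian_product)
  also have "card A * card B \<le> card A * card A"
    using assms by simp
  finally have "2 * card (pairs_at A B) \<le> card A * (card A - 1) + 2 * (card A * card A)"
    by (simp add: choose_two)
  also have "\<dots> \<le> card A * card A + 2 * (card A * card A)"
    by simp
  finally have "real (2 * card (pairs_at A B)) \<le> real (3 * (card A * card A))"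
    unfolding of_nat_le_iff by simp
  then show ?thesis
    by (simp add: power2_eq_square)
qed

section \<open>Orientations without a Seymour vertex\<close>

lemma pair_digraph_orientation:
  assumes "pair_graph G" "is_orientation G D"
  shows "pair_digraph D"
proof -
  interpret pair_graph G by fact
  have "parcs D \<subseteq> parcs G" "pverts D = pverts G"
    using assms by (auto simp: is_orientation_def)
  then show ?thesis
    by unfold_locales
       (use in_arcsD1 in_arcsD2 pair_no_loops finite_subset[OF _ pair_finite_arcs] pair_finite_verts
        in \<open>auto simp: in_mono\<close>)
qed

text \<open>The path through v has two arcs; a shorter one would be empty or a single arc, and the
  last two hypotheses exclude these.\<close>

lemma out_nbhd_2_superset:
  assumes "pair_digraph D" "(u, v) \<in> parcs D" "(v, w) \<in> parcs D" "(u, w) \<notin> parcs D" "u \<noteq> w"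
  shows "w \<in> out_nbhd D 2 u"
proof -
  interpret pair_digraph D by fact
  have "u \<noteq> v" "v \<noteq> w"
    using assms pair_no_loops by force+
  have long: "2 \<le> length q" if "apath u q w" for q
  proof (rule ccontr)
    assume "\<not> 2 \<le> length q"
    then consider "q = []" | a where "q = [a]"
      by (cases q; cases "tl q") auto
    then show False
      using that assms by cases (auto simp: apath_def awalk_def)
  qed
  have "apath u [(u, v), (v, w)] w"
    using assms \<open>u \<noteq> v\<close> \<open>v \<noteq> w\<close> in_arcsD1 in_arcsD2 by (auto simp: apath_def awalk_def)
  then have "is_arg_min length (\<lambda>q. apath u q w) [(u, v), (v, w)]"
    using long by (force simp: is_arg_min_def)
  then show ?thesis
    unfolding out_nbhd_def by force
qed

lemma out_nbhd_subset:
  assumes "pair_digraph D"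
  shows "out_nbhd D i u \<subseteq> pverts D"
proof -
  interpret pair_digraph D by fact
  show ?thesis
    by (auto simp: out_nbhd_def is_arg_min_def apath_def)
qed

text \<open>This replaces the orientation by a density condition on G itself: D survives only
  through the size of A. The later union bound thus ranges over pairs of vertex sets and not over
  orientations.\<close>

lemma dense_pair_if_no_seymour_vertex:
  assumes G: "pair_graph G" "pverts G \<noteq> {}" and D: "is_orientation G D"
    and no: "\<And>u. \<not> seymour_vertex D u"
  obtains A B where "A \<subseteq> pverts G" "B \<subseteq> pverts G" "card B \<le> card A" "card A = min_out_degree D"
    "(card A)\<^sup>2 \<le> card (pairs_at A B \<inter> edge_set G)"
proof -
  have dig: "pair_digraph D"
    using pair_digraph_orientation G D by blast
  interpret pair_digraph D by (rule dig)
  have verts: "pverts D = pverts G" and arcs: "parcs D \<subseteq> parcs G"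
    and asym: "\<And>x y. (x, y) \<in> parcs D \<Longrightarrow> (y, x) \<notin> parcs D"
    using D by (auto simp: is_orientation_def)
  define N where "N v = {w. (v, w) \<in> parcs D}" for v
  have deg: "out_degree (with_proj D) v = card (N v)" for v
  proof -
    have "out_arcs (with_proj D) v = Pair v ` N v"
      by (auto simp: out_arcs_def N_def)
    then show ?thesis
      by (simp add: out_degree_def card_image inj_on_def)
  qed
  have N_sub: "N v \<subseteq> pverts D" for v
    using in_arcsD2 by (auto simp: N_def)
  then have fin_N: "finite (N v)" for v
    using finite_subset pair_finite_verts by blast
  have "min_out_degree D \<in> out_degree (with_proj D) ` pverts D"
    unfolding min_out_degree_def by (rule Min_in) (use G verts pair_finite_verts in auto)
  then obtain u where u: "u \<in> pverts D" "card (N u) = min_out_degree D"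
    by (auto simp: deg)
  have deg_ge: "card (N u) \<le> card (N v)" if "v \<in> pverts D" for v
    using that pair_finite_verts unfolding u min_out_degree_def by (auto simp: deg)
  define B where "B = out_nbhd D 2 u"
  have B_sub: "B \<subseteq> pverts D"
    unfolding B_def by (rule out_nbhd_subset[OF dig])
  then have fin_B: "finite B"
    using finite_subset pair_finite_verts by blast
  have "out_nbhd D 1 u = N u"
    unfolding N_def by (rule out_nbhd_1[OF dig])
  then have "card B \<le> card (N u)"
    using no[of u] u by (simp add: seymour_vertex_def B_def)
  moreover have "(card (N u))\<^sup>2 \<le> card (pairs_at (N u) B \<inter> edge_set G)"
  proof -
    let ?S = "SIGMA v:N u. N v"
    have "(card (N u))\<^sup>2 = (\<Sum>v\<in>N u. card (N u))"
      by (simp add: power2_eq_square)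
    also have "\<dots> \<le> (\<Sum>v\<in>N u. card (N v))"
      by (intro sum_mono deg_ge) (use N_sub in auto)
    also have "\<dots> = card ?S"
      by (simp add: card_SigmaI fin_N)
    \<comment> \<open>No edge is directed both ways, so distinct arcs leaving \<open>N u\<close>
      come from distinct edges.\<close>
    also have "\<dots> = card ((\<lambda>(x, y). {x, y}) ` ?S)"
    proof (rule card_image [symmetric])
      show "inj_on (\<lambda>(x, y). {x, y}) ?S"
        using asym by (auto simp: inj_on_def N_def doubleton_eq_iff)
    qed
    also have "\<dots> \<le> card (pairs_at (N u) B \<inter> edge_set G)"
    proof (rule card_mono)
      show "finite (pairs_at (N u) B \<inter> edge_set G)"
        using finite_pairs_at fin_N fin_B by blast
      have "{v, w} \<in> pairs_at (N u) B \<inter> edge_set G" if "v \<in> N u" "w \<in> N v" for v w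
      proof -
        have vw: "(u, v) \<in> parcs D" "(v, w) \<in> parcs D"
          using that by (auto simp: N_def)
        \<comment> \<open>The head w cannot be u, since the arc from u to v would then be reversed;
          hence w is at distance 1 or 2 from u.\<close>
        then have "u \<noteq> w" "v \<noteq> w"
          using asym by blast+
        then have "w \<in> N u \<union> B"
          using out_nbhd_2_superset[OF dig vw] by (auto simp: N_def B_def)
        then have "{v, w} \<in> pairs_at (N u) B"
          using \<open>v \<in> N u\<close> \<open>v \<noteq> w\<close> by (auto simp: pairs_at_def)
        moreover have "{v, w} \<in> edge_set G"
          using vw arcs by (force simp: edge_set_def)
        ultimately show ?thesis by blast
      qed
      then show "(\<lambda>(x, y). {x, y}) ` ?S \<subseteq> pairs_at (N u) B \<inter> edge_set G"
        by auto
    qed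
    finally show ?thesis .
  qed
  ultimately show thesis
    using that N_sub B_sub u verts by metis
qed

section \<open>Tail bound for one pair of sets\<close>

text \<open>The edges are independent Bernoulli coordinates, and the marginal of the product on S is
  again such a product, whose number of successes is binomial.\<close>

lemma map_pmf_card_edges_random_graph:
  assumes "0 \<le> p" "p \<le> 1" "S \<subseteq> vertex_pairs n"
  shows "map_pmf (\<lambda>G. card (S \<inter> edge_set G)) (random_graph n p) = binomial_pmf (card S) p"
proof -
  let ?G = "\<lambda>X. \<lparr>pverts = {1..n}, parcs = {(u, v). {u, v} \<in> vertex_pairs n \<and> X {u, v}}\<rparr>"
  have finS: "finite S"
    using assms finite_subset finite_vertex_pairs by blast
  have edges: "edge_set (?G X) = {e \<in> vertex_pairs n. X e}" for X
  proof -
    have "e \<in> edge_set (?G X)" if "e \<in> vertex_pairs n" "X e" for e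
    proof -
      obtain x y where "e = {x, y}"
        using \<open>e \<in> _\<close> unfolding vertex_pairs_def card_2_iff by blast
      then show ?thesis
        using that by (force simp: edge_set_def)
    qed
    then show ?thesis
      by (auto simp: edge_set_def)
  qed
  have "binomial_pmf (card S) p =
      map_pmf (\<lambda>X. card {e \<in> S. X e}) (Pi_pmf S False (\<lambda>_. bernoulli_pmf p))"
    by (rule binomial_pmf_altdef') (use assms finS in auto)
  \<comment> \<open>Restricting the coordinates to S resets those outside to the default
    \<open>False\<close>; the count only looks inside S.\<close>
  also have "\<dots> = map_pmf (\<lambda>X. card {e \<in> S. if e \<in> S then X e else False})
      (Pi_pmf (vertex_pairs n) False (\<lambda>_. bernoulli_pmf p))"
    by (simp add: Pi_pmf_subset[OF finite_vertex_pairs assms(3)] map_pmf_comp)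
  also have "\<dots> = map_pmf (\<lambda>G. card (S \<inter> edge_set G)) (random_graph n p)"
    unfolding random_graph_def map_pmf_comp edges
    by (intro map_pmf_cong refl arg_cong[of _ _ card]) (use assms in auto)
  finally show ?thesis ..
qed

lemma prob_dense_pair_le:
  assumes p_le: "0 \<le> p" "p \<le> 2 / 3 - \<gamma>" and "\<gamma> > 0"
    and AB: "A \<subseteq> {1..n}" "B \<subseteq> {1..n}" "card B \<le> card A" and a: "card A > 0"
  shows "measure_pmf.prob (random_graph n p) {G. (card A)\<^sup>2 \<le> card (pairs_at A B \<inter> edge_set G)}
    \<le> exp (- 3 * \<gamma>\<^sup>2 * (real (card A))\<^sup>2)"
proof -
  define a where "a = real (card A)"
  define m where "m = card (pairs_at A B)"
  have "a > 0"
    using a by (simp add: a_def)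
  have "finite A" "finite B"
    using AB finite_subset by blast+
  then have m: "real m \<le> 3 / 2 * a\<^sup>2"
    using card_pairs_at_le AB by (simp add: a_def m_def)
  have S: "pairs_at A B \<subseteq> vertex_pairs n"
    using AB by (auto simp: pairs_at_def vertex_pairs_def card_insert_if)
  have "measure_pmf.prob (random_graph n p) {G. (card A)\<^sup>2 \<le> card (pairs_at A B \<inter> edge_set G)}
     = measure_pmf.prob (map_pmf (\<lambda>G. card (pairs_at A B \<inter> edge_set G)) (random_graph n p))
         {x. (card A)\<^sup>2 \<le> x}"
    by (simp add: vimage_def)
  also have "\<dots> = measure_pmf.prob (binomial_pmf m p) {x. (card A)\<^sup>2 \<le> x}"
    using p_le \<open>\<gamma> > 0\<close> by (subst map_pmf_card_edges_random_graph[OF _ _ S]) (auto simp: m_def)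
  also have "{x. (card A)\<^sup>2 \<le> x} = {x. a\<^sup>2 \<le> real x}"
    unfolding a_def of_nat_power [symmetric] of_nat_le_iff ..
  also have "measure_pmf.prob (binomial_pmf m p) {x. a\<^sup>2 \<le> real x} \<le> exp (- 3 * \<gamma>\<^sup>2 * a\<^sup>2)"
  \<comment> \<open>Hoeffding's exponent divides by m. For m = 0 the count is 0, which is below the
    positive threshold.\<close>
  proof (cases "m = 0")
    case True
    then show ?thesis
      using p_le \<open>\<gamma> > 0\<close> \<open>a > 0\<close> by (simp add: binomial_pmf_0 indicator_def)
  next
    case False
    interpret binomial_distribution m p
      by unfold_locales (use p_le \<open>\<gamma> > 0\<close> in auto)
    \<comment> \<open>The factors 3/2 and 2/3 cancel, so the mean stays below the threshold by the
      deviation 3/2 * \<gamma> * \<open>a\<^sup>2\<close> used in Hoeffding's inequality.\<close>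
    have "real m * p \<le> 3 / 2 * a\<^sup>2 * (2 / 3 - \<gamma>)"
      using m p_le by (intro mult_mono) auto
    also have "\<dots> = a\<^sup>2 - 3 / 2 * \<gamma> * a\<^sup>2"
      by (simp add: right_diff_distrib)
    finally have "real m * p + 3 / 2 * \<gamma> * a\<^sup>2 \<le> a\<^sup>2"
      by simp
    then have "measure_pmf.prob (binomial_pmf m p) {x. a\<^sup>2 \<le> real x}
        \<le> measure_pmf.prob (binomial_pmf m p) {x. real m * p + 3 / 2 * \<gamma> * a\<^sup>2 \<le> real x}"
      by (intro measure_pmf.finite_measure_mono) auto
    also have "\<dots> \<le> exp (- 2 * (3 / 2 * \<gamma> * a\<^sup>2)\<^sup>2 / real m)"
      by (rule prob_ge) (use False \<open>\<gamma> > 0\<close> in auto)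
    also have "\<dots> \<le> exp (- 3 * \<gamma>\<^sup>2 * a\<^sup>2)"
    proof -
      have "3 * \<gamma>\<^sup>2 * a\<^sup>2 * real m \<le> 3 * \<gamma>\<^sup>2 * a\<^sup>2 * (3 / 2 * a\<^sup>2)"
        using m by (intro mult_left_mono) auto
      also have "\<dots> = 2 * (3 / 2 * \<gamma> * a\<^sup>2)\<^sup>2"
        by (simp add: power2_eq_square)
      finally show ?thesis
        using False by (simp add: field_simps)
    qed
    finally show ?thesis .
  qed
  finally show ?thesis
    unfolding a_def .
qed

section \<open>Union bound over all pairs of sets\<close>

lemma prob_no_seymour_vertex_le:
  assumes p: "0 \<le> p" "p \<le> 2 / 3 - \<gamma>" and "\<gamma> > 0" "n > 0"
  shows "measure_pmf.prob (random_graph n p)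
      {G. \<exists>D. is_orientation G D \<and> real (min_out_degree D) \<ge> 1 / \<gamma> * sqrt (real n) \<and>
              (\<forall>u. \<not> seymour_vertex D u)} \<le> (4 * exp (- 3)) ^ n"
    (is "measure_pmf.prob ?M ?bad \<le> _")
proof -
  define I where "I = {(A, B). A \<subseteq> {1..n} \<and> B \<subseteq> {1..n} \<and> card B \<le> card A \<and>
                         1 / \<gamma> * sqrt (real n) \<le> real (card A)}"
  define E where "E = (\<lambda>(A, B). {G :: nat pair_pre_digraph. (card A)\<^sup>2 \<le> card (pairs_at A B \<inter> edge_set G)})"
  have I_sub: "I \<subseteq> Pow {1..n} \<times> Pow {1..n}"
    by (auto simp: I_def)
  then have "finite I"
    by (rule finite_subset) auto
  have "card I \<le> card (Pow {1..n} \<times> Pow {1..n})"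
    using I_sub by (intro card_mono) auto
  also have "\<dots> = 4 ^ n"
    by (simp add: card_cartesian_product card_Pow flip: power_mult_distrib)
  finally have "real (card I) \<le> real (4 ^ n)"
    unfolding of_nat_le_iff .
  \<comment> \<open>Only graphs in the support are known to be simple with vertex set
    \<open>{1..n}\<close>; the intersection does not change the probability.\<close>
  have "?bad \<inter> set_pmf ?M \<subseteq> (\<Union>i\<in>I. E i)"
  proof
    fix G assume "G \<in> ?bad \<inter> set_pmf ?M"
    then obtain D where D: "is_orientation G D" "1 / \<gamma> * sqrt (real n) \<le> real (min_out_degree D)"
        "\<And>u. \<not> seymour_vertex D u" and G: "G \<in> set_pmf ?M"
      by blast
    have verts: "pverts G = {1..n}"
      using G by (auto simp: random_graph_def)
    have "pair_graph G" "pverts G \<noteq> {}"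
      using pair_graph_random_graph[OF G] verts \<open>n > 0\<close> by auto
    then obtain A B where "A \<subseteq> pverts G" "B \<subseteq> pverts G" "card B \<le> card A"
        "card A = min_out_degree D" "(card A)\<^sup>2 \<le> card (pairs_at A B \<inter> edge_set G)"
      using dense_pair_if_no_seymour_vertex D(1,3) by metis
    then have "(A, B) \<in> I" "G \<in> E (A, B)"
      using D(2) by (auto simp: I_def E_def verts)
    then show "G \<in> (\<Union>i\<in>I. E i)"
      by blast
  qed
  then have "measure_pmf.prob ?M (?bad \<inter> set_pmf ?M) \<le> measure_pmf.prob ?M (\<Union>i\<in>I. E i)"
    by (intro measure_pmf.finite_measure_mono) auto
  also have "\<dots> \<le> (\<Sum>i\<in>I. measure_pmf.prob ?M (E i))"
    by (rule measure_UNION_le) (use \<open>finite I\<close> in auto)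
  also have "\<dots> \<le> (\<Sum>i\<in>I. exp (- 3) ^ n)"
  proof (rule sum_mono)
    fix i assume "i \<in> I"
    then obtain A B where AB: "i = (A, B)" "A \<subseteq> {1..n}" "B \<subseteq> {1..n}" "card B \<le> card A"
        and large: "1 / \<gamma> * sqrt (real n) \<le> real (card A)"
      by (auto simp: I_def)
    have sq: "sqrt (real n) \<le> \<gamma> * real (card A)"
      using large \<open>\<gamma> > 0\<close> by (simp add: field_simps)
    have "0 < sqrt (real n)"
      using \<open>n > 0\<close> by simp
    with sq have "card A > 0"
      by (cases "card A") auto
    have "real n = (sqrt (real n))\<^sup>2"
      by simp
    also have "\<dots> \<le> (\<gamma> * real (card A))\<^sup>2"
      using sq by (intro power_mono) auto
    \<comment> \<open>This is where the degree bound enters: the tail exponent becomes at most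
      -3n.\<close>
    finally have n_le: "real n \<le> \<gamma>\<^sup>2 * (real (card A))\<^sup>2"
      by (simp add: power_mult_distrib)
    have "measure_pmf.prob ?M (E i) \<le> exp (- 3 * \<gamma>\<^sup>2 * (real (card A))\<^sup>2)"
      unfolding E_def AB using prob_dense_pair_le[OF p \<open>\<gamma> > 0\<close> AB(2-4) \<open>card A > 0\<close>] by simp
    also have "\<dots> \<le> exp (real n * (- 3))"
      using n_le by simp
    also have "\<dots> = exp (- 3) ^ n"
      by (rule exp_of_nat_mult)
    finally show "measure_pmf.prob ?M (E i) \<le> exp (- 3) ^ n" .
  qed
  also have "\<dots> = real (card I) * exp (- 3) ^ n"
    by simp
  also have "\<dots> \<le> real (4 ^ n) * exp (- 3) ^ n"
    by (intro mult_right_mono) (use \<open>real (card I) \<le> _\<close> in auto)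
  also have "\<dots> = (4 * exp (- 3)) ^ n"
    by (simp add: power_mult_distrib)
  finally show ?thesis
    by (simp add: measure_Int_set_pmf)
qed

section \<open>Passage to the limit\<close>

theorem theorem3:
  fixes \<beta> :: real
  assumes "\<beta> > 0"
  shows "\<exists>C :: real. \<forall>p :: nat \<Rightarrow> real.
           (\<forall>n. 0 < p n \<and> p n < 1) \<longrightarrow>
           limsup (\<lambda>n. ereal (p n)) \<le> ereal (2 / 3 - \<beta>) \<longrightarrow>
           (\<lambda>n. measure_pmf.prob (random_graph n (p n))
              {G. \<forall>D. is_orientation G D \<and> real (min_out_degree D) \<ge> C * sqrt (real n) \<longrightarrow>
                      (\<exists>u. seymour_vertex D u)})
             \<longlonglongrightarrow> 1"
proof (intro exI allI impI)
  fix p :: "nat \<Rightarrow> real"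
  assume p: "\<forall>n. 0 < p n \<and> p n < 1" and lim: "limsup (\<lambda>n. ereal (p n)) \<le> ereal (2 / 3 - \<beta>)"
  \<comment> \<open>Half of the slack \<beta> is given up so that p(n) lies below 2/3 - \<gamma> for
    all large n, as a limsup bound gives only eventual strict inequalities.\<close>
  define \<gamma> where "\<gamma> = \<beta> / 2"
  have "\<gamma> > 0"
    using assms by (simp add: \<gamma>_def)
  let ?good = "\<lambda>n. {G. \<forall>D. is_orientation G D \<and> real (min_out_degree D) \<ge> 1 / \<gamma> * sqrt (real n) \<longrightarrow>
                      (\<exists>u. seymour_vertex D u)}"
  let ?P = "\<lambda>n. measure_pmf.prob (random_graph n (p n)) (?good n)"
  have "limsup (\<lambda>n. ereal (p n)) < ereal (2 / 3 - \<gamma>)"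
    by (rule le_less_trans[OF lim]) (use assms in \<open>simp add: \<gamma>_def\<close>)
  then have "eventually (\<lambda>n. ereal (p n) < ereal (2 / 3 - \<gamma>)) sequentially"
    by (rule Limsup_lessD)
  then have lower: "eventually (\<lambda>n. 1 - (4 * exp (- 3)) ^ n \<le> ?P n) sequentially"
    using eventually_gt_at_top[of 0]
  proof eventually_elim
    case (elim n)
    have bad: "- ?good n = {G. \<exists>D. is_orientation G D \<and>
        real (min_out_degree D) \<ge> 1 / \<gamma> * sqrt (real n) \<and> (\<forall>u. \<not> seymour_vertex D u)}"
      by auto
    have "measure_pmf.prob (random_graph n (p n)) (- ?good n) \<le> (4 * exp (- 3)) ^ n"
      unfolding bad
      by (rule prob_no_seymour_vertex_le) (use p elim \<open>\<gamma> > 0\<close> in \<open>auto simp: less_imp_le\<close>)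
    moreover have "measure_pmf.prob (random_graph n (p n)) (- ?good n) = 1 - ?P n"
      using measure_pmf.prob_compl[of "?good n" "random_graph n (p n)"] by (simp add: Compl_eq_Diff_UNIV)
    ultimately show ?case
      by simp
  qed
  \<comment> \<open>Squaring exp (3/2) \<ge> 1 + 3/2 gives exp 3 \<ge> 25/4.\<close>
  have "4 < exp (3 :: real)"
    using exp_ge_add_one_self[of "3/2::real"]
      mult_mono[of "5/2" "exp (3/2)" "5/2::real" "exp (3/2)"] by (simp flip: exp_add)
  then have "4 * exp (- 3 :: real) < 1"
    by (simp add: exp_minus field_simps)
  then have "(\<lambda>n. (4 * exp (- 3 :: real)) ^ n) \<longlonglongrightarrow> 0"
    by (intro LIMSEQ_realpow_zero) auto
  from tendsto_diff[OF tendsto_const[of 1] this]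
  have "(\<lambda>n. 1 - (4 * exp (- 3 :: real)) ^ n) \<longlonglongrightarrow> 1"
    by simp
  then have "?P \<longlonglongrightarrow> 1"
    by (intro tendsto_sandwich[OF lower _ _ tendsto_const]) auto
  \<comment> \<open>The witness C, left open so far, is fixed here as 2 / \<beta> = 1 / \<gamma>; it
    is independent of p.\<close>
  then show "(\<lambda>n. measure_pmf.prob (random_graph n (p n))
              {G. \<forall>D. is_orientation G D \<and> real (min_out_degree D) \<ge> 2 / \<beta> * sqrt (real n) \<longrightarrow>
                      (\<exists>u. seymour_vertex D u)}) \<longlonglongrightarrow> 1"
    by (simp add: \<gamma>_def)
qed

end
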